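(* Fix a threshold $\alpha$, and let $\theta_0^{\mathrm{TPR}(\alpha)}:=\Pr(R>\alpha\mid Y=1)$ under the full data distribution. Define $$\hat\theta_{C/\pi(X)}:=\frac{\sum_{i=1}^{n+N}\frac{C_i}{\pi(X_i)}I(R_i>\alpha)Y_i}{\sum_{i=1}^{n+N}\frac{C_i}{\pi(X_i)}Y_i},\quad \hat\theta^f_{C/\pi(X)}:=\frac{\sum_{i=1}^{n+N}\frac{C_i}{\pi(X_i)}I(R_i>\alpha)f(X_i)}{\sum_{i=1}^{n+N}\frac{C_i}{\pi(X_i)}f(X_i)},\quad \hat\theta^f:=\frac{\sum_{i=1}^{n+N}I(R_i>\alpha)f(X_i)}{\sum_{i=1}^{n+N}f(X_i)},$$ and $\hat\theta:=\hat\theta_{C/\pi(X)}+\hat\omega\big(\hat\theta^f-\hat\theta^f_{C/\pi(X)}\big)$. Assume that $(X_i,C_i,Y_i)_{i=1}^{n+N}$ are i.i.d., that $C$ is conditionally independent of $Y$ given $X$, that $\epsilon<\pi(X)<1-\epsilon$ for some $\epsilon>0$, and that $$\hat\omega\xrightarrow{p}\frac{\operatorname{Cov}\left(\frac{C_i}{\pi(X_i)}\phi^{\mathrm{TPR}(\alpha)}(R_i,Y_i),\ \Big(\frac{C_i}{\pi(X_i)}-1\Big)\phi^{\mathrm{TPR}(\alpha)}(R_i,f(X_i))\right)}{\operatorname{Var}\left(\Big(1-\frac{C_i}{\pi(X_i)}\Big)\phi^{\mathrm{TPR}(\alpha)}(R_i,f(X_i))\right)}.$$ Then, as $n+N\to\infty$,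 $\sqrt{n+N}\,(\hat\theta-\theta_0^{\mathrm{TPR}(\alpha)})\xrightarrow{d}N(0,\sigma^2)$, where $$\sigma^2=\operatorname{Var}\left(\frac{C_i}{\pi(X_i)}\phi^{\mathrm{TPR}(\alpha)}(R_i,Y_i)\right)-\frac{\operatorname{Cov}\left(\frac{C_i}{\pi(X_i)}\phi^{\mathrm{TPR}(\alpha)}(R_i,Y_i),\ \Big(1-\frac{C_i}{\pi(X_i)}\Big)\phi^{\mathrm{TPR}(\alpha)}(R_i,f(X_i))\right)^2}{\operatorname{Var}\left(\Big(1-\frac{C_i}{\pi(X_i)}\Big)\phi^{\mathrm{TPR}(\alpha)}(R_i,f(X_i))\right)}.$$
   Context: Setting: $(X,C,Y)\sim\mathbb Q^*$ (the full data distribution), $Y\in\{0,1\}$ with $0<\Pr(Y=1)<1$, $C\in\{0,1\}$ the indicator that $Y$ is observed; observed data are $(X_i,C_i,C_iY_i)_{i=1}^{n+N}$. $R$ is a real-valued biomarker, one of the components of the vector $X$. $\pi(X)=\Pr(C=1\mid X)$ is known. $f$ is a fixed deterministic function with $f(X)\ge0$, $\mathbb E[f(X)](1-\mathbb E[f(X)])\ne0$ and $\mathbb E[f(X)^2]<\infty$. Under $\mathbb Q^*$, $$\phi^{\mathrm{TPR}(\alpha)}(R_i,Y_i)=\frac{I(R_i>\alpha)Y_i}{\mathbb E[Y]}-\frac{\mathbb E[I(R>\alpha)Y]\,Y_i}{\mathbb E[Y]^2},\qquad \phi^{\mathrm{TPR}(\alpha)}(R_i,f(X_i))=\frac{I(R_i>\alpha)f(X_i)}{\mathbb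 E[f(X)]}-\frac{\mathbb E[I(R>\alpha)f(X)]\,f(X_i)}{\mathbb E[f(X)]^2}.$$ The variance in the denominator of the limit of $\hat\omega$ is assumed positive. *)

theory Defs
  imports "HOL-Probability.Probability"
begin

text \<open>A full-data record is a triple (X, C, Y): covariate vector, observation indicator and
  binary outcome, the last two coded as reals.\<close>

type_synonym 'd full_data = "(real ^ 'd) \<times> real \<times> real"

abbreviation cov_of :: "'d::finite full_data \<Rightarrow> real ^ 'd" where
  "cov_of z \<equiv> fst z"

abbreviation obs_of :: "'d::finite full_data \<Rightarrow> real" where
  "obs_of z \<equiv> fst (snd z)"

abbreviation out_of :: "'d::finite full_data \<Rightarrow> real" where
  "out_of z \<equiv> snd (snd z)"

abbreviation full_data_algebra :: "'d::finite full_data measure" where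
  "full_data_algebra \<equiv> borel \<Otimes>\<^sub>M borel \<Otimes>\<^sub>M borel"

definition generated_by :: "'a measure \<Rightarrow> ('a \<Rightarrow> 'b::topological_space) \<Rightarrow> 'a measure" where
  "generated_by M X = vimage_algebra (space M) X borel"

text \<open>Conditional independence of the real random variables U and V given X.\<close>

definition cond_indep_given ::
  "'a measure \<Rightarrow> ('a \<Rightarrow> real) \<Rightarrow> ('a \<Rightarrow> real) \<Rightarrow> ('a \<Rightarrow> 'b::topological_space) \<Rightarrow> bool" where
  "cond_indep_given M U V X \<longleftrightarrow>
     (\<forall>A \<in> sets borel. \<forall>B \<in> sets borel. AE z in M.
        real_cond_exp M (generated_by M X) (\<lambda>z. of_bool (U z \<in> A \<and> V z \<in> B)) z =
        real_cond_exp M (generated_by M X) (\<lambda>z. of_bool (U z \<in> A)) z *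
        real_cond_exp M (generated_by M X) (\<lambda>z. of_bool (V z \<in> B)) z)"

definition covariance :: "'a measure \<Rightarrow> ('a \<Rightarrow> real) \<Rightarrow> ('a \<Rightarrow> real) \<Rightarrow> real" where
  "covariance M U V =
     (\<integral>z. (U z - integral\<^sup>L M U) * (V z - integral\<^sup>L M V) \<partial>M)"

definition tendsto_in_prob ::
  "'a measure \<Rightarrow> (nat \<Rightarrow> 'a \<Rightarrow> real) \<Rightarrow> real \<Rightarrow> bool" where
  "tendsto_in_prob M Z c \<longleftrightarrow>
     (\<forall>\<epsilon>>0. (\<lambda>m. \<P>(w in M. \<epsilon> < \<bar>Z m w - c\<bar>)) \<longlonglongrightarrow> 0)"

text \<open>The normal law with mean \<open>\<mu>\<close> and variance \<open>v\<close>. The density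
  \<open>normal_density \<mu> 0\<close> is identically 0, so the degenerate case \<open>v = 0\<close> has to be given
  separately as the point mass at \<open>\<mu>\<close>.\<close>

definition normal_law :: "real \<Rightarrow> real \<Rightarrow> real measure" where
  "normal_law \<mu> v =
     (if v = 0 then return borel \<mu> else density lborel (\<lambda>x. ennreal (normal_density \<mu> (sqrt v) x)))"

text \<open>The influence function \<open>\<phi>\<close> of the true positive rate at threshold \<open>\<alpha>\<close>; it is used with the
  outcome \<open>L = Y\<close> and with the surrogate label \<open>L = f(X)\<close>.\<close>

definition phi_TPR ::
  "'a measure \<Rightarrow> ('a \<Rightarrow> real) \<Rightarrow> real \<Rightarrow> ('a \<Rightarrow> real) \<Rightarrow> 'a \<Rightarrow> real" where
  "phi_TPR Q R \<alpha> L z =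
     of_bool (R z > \<alpha>) * L z / (\<integral>u. L u \<partial>Q)
     - (\<integral>u. of_bool (R u > \<alpha>) * L u \<partial>Q) * L z / (\<integral>u. L u \<partial>Q)\<^sup>2"

end

theory Submission
  imports Defs
begin

text \<open>The scaled error of a ratio of sample means with target \<open>\<theta> = E u / E v\<close> is the scaled sum of the
  centred variables \<open>u - \<theta> v\<close> divided by the sample mean of \<open>v\<close>, hence by the weak law equal to the scaled
  sum of the influence function \<open>(u - \<theta> v) / E v\<close> up to an error tending to 0 in probability. Conditional
  independence makes inverse probability weighting unbiased, so this applies to all three ratios with the
  influence functions \<open>W \<phi>Y\<close>, \<open>W \<phi>f\<close> and \<open>\<phi>f\<close>, where \<open>W = C / \<pi>(X)\<close>. Since scaled sums are bounded in
  probability, \<open>\<omega>_hat\<close> may be replaced by its limit \<open>\<omega>0\<close>, and the scaled error of the estimator is asymptotically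
  the scaled sum of \<open>W \<phi>Y + \<omega>0 (1 - W) \<phi>f\<close>. The central limit theorem and Slutsky's theorem (via characteristic
  functions) give the normal limit; \<open>\<omega>0\<close> is the coefficient minimizing the variance, whence the form of \<open>\<sigma>2\<close>.\<close>

subsection \<open>Stochastic order symbols\<close>

text \<open>One \<open>K\<close> serves all \<open>m\<close>, not only large ones. Chebyshev's
  inequality gives this form for scaled sums, and \<open>K\<close> can then be fixed before
  \<open>m\<close> grows.\<close>

definition bounded_in_prob :: "'a measure \<Rightarrow> (nat \<Rightarrow> 'a \<Rightarrow> real) \<Rightarrow> bool" where
  "bounded_in_prob M Z \<longleftrightarrow> (\<forall>\<eta>>0. \<exists>K. \<forall>m. \<P>(w in M. K < \<bar>Z m w\<bar>) \<le> \<eta>)"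

lemma integrable_mult_square_integrable:
  fixes u v :: "'a \<Rightarrow> real"
  assumes [measurable]: "u \<in> borel_measurable M" "v \<in> borel_measurable M"
    and u: "integrable M (\<lambda>z. (u z)\<^sup>2)" and v: "integrable M (\<lambda>z. (v z)\<^sup>2)"
  shows "integrable M (\<lambda>z. u z * v z)"
proof (rule Bochner_Integration.integrable_bound[OF Bochner_Integration.integrable_add[OF u v]])
  have "\<bar>u z * v z\<bar> \<le> (u z)\<^sup>2 + (v z)\<^sup>2" for z
    using sum_squares_bound[of "\<bar>u z\<bar>" "\<bar>v z\<bar>"] mult_nonneg_nonneg[of "\<bar>u z\<bar>" "\<bar>v z\<bar>"]
    unfolding abs_mult power2_abs by linarith
  then show "AE z in M. norm (u z * v z) \<le> norm ((u z)\<^sup>2 + (v z)\<^sup>2)"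
    by (intro AE_I2) simp
qed simp

context prob_space
begin

lemma tendsto_in_prob_diff_0:
  "tendsto_in_prob M (\<lambda>m w. Z m w - c) 0 \<longleftrightarrow> tendsto_in_prob M Z c"
  by (simp add: tendsto_in_prob_def)

text \<open>Reduces rules for stochastic remainders to a deterministic estimate on the event where
  \<open>X\<close> and \<open>X'\<close> are small and \<open>T\<close> is bounded; a union bound
  handles the complement. The sum, product and quotient rules below are instances, with a constant
  \<open>T\<close> or a repeated \<open>X\<close> where fewer ingredients occur.\<close>

lemma tendsto_in_prob_bound:
  assumes Z[measurable]: "\<And>m. Z m \<in> borel_measurable M"
    and [measurable]: "\<And>m. X m \<in> borel_measurable M" "\<And>m. X' m \<in> borel_measurable M"
      "\<And>m. T m \<in> borel_measurable M"
    and X: "tendsto_in_prob M X 0" and X': "tendsto_in_prob M X' 0"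
    and T: "bounded_in_prob M T"
    and small: "\<And>\<epsilon> K. \<epsilon> > 0 \<Longrightarrow> K > 0 \<Longrightarrow> \<exists>\<delta>>0. \<forall>m. \<forall>w\<in>space M.
      \<bar>X m w\<bar> \<le> \<delta> \<longrightarrow> \<bar>X' m w\<bar> \<le> \<delta> \<longrightarrow> \<bar>T m w\<bar> \<le> K \<longrightarrow> \<bar>Z m w\<bar> \<le> \<epsilon>"
  shows "tendsto_in_prob M Z 0"
  unfolding tendsto_in_prob_def
proof (intro allI impI)
  fix \<epsilon> :: real assume \<epsilon>: "\<epsilon> > 0"
  show "(\<lambda>m. \<P>(w in M. \<epsilon> < \<bar>Z m w - 0\<bar>)) \<longlonglongrightarrow> 0"
  proof (rule order_tendstoI)
    fix \<eta> :: real assume "0 < \<eta>"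
    then obtain K0 where K0: "\<And>m. \<P>(w in M. K0 < \<bar>T m w\<bar>) \<le> \<eta> / 2"
      using T unfolding bounded_in_prob_def by (metis half_gt_zero)
    \<comment> \<open>\<open>small\<close> asks for a positive bound, which \<open>K0\<close> need
      not be.\<close>
    define K where "K = max K0 1"
    have K: "\<P>(w in M. K < \<bar>T m w\<bar>) \<le> \<eta> / 2" for m
      by (rule order_trans[OF finite_measure_mono K0]) (auto simp: K_def)
    obtain \<delta> where \<delta>: "\<delta> > 0" "\<And>m w. w \<in> space M \<Longrightarrow> \<bar>X m w\<bar> \<le> \<delta> \<Longrightarrow> \<bar>X' m w\<bar> \<le> \<delta> \<Longrightarrow>
        \<bar>T m w\<bar> \<le> K \<Longrightarrow> \<bar>Z m w\<bar> \<le> \<epsilon>"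
    proof -
      have "K > 0" by (simp add: K_def)
      from small[OF \<epsilon> this] show ?thesis using that by blast
    qed
    have ev: "\<forall>\<^sub>F m in sequentially. \<P>(w in M. \<delta> < \<bar>V m w\<bar>) < \<eta> / 4"
      if "tendsto_in_prob M V 0" for V
      using order_tendstoD(2)[of _ 0 sequentially "\<eta> / 4"] that \<open>0 < \<eta>\<close> \<delta>(1)
      by (auto simp: tendsto_in_prob_def)
    show "\<forall>\<^sub>F m in sequentially. \<P>(w in M. \<epsilon> < \<bar>Z m w - 0\<bar>) < \<eta>"
      using ev[OF X] ev[OF X']
    proof eventually_elim
      case (elim m)
      \<comment> \<open>The budget \<eta> is split into a half for the tail of \<open>T\<close> and
        a quarter each for \<open>X\<close> and \<open>X'\<close>.\<close>
      have "\<P>(w in M. \<epsilon> < \<bar>Z m w - 0\<bar>) \<le>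
          prob ({w\<in>space M. \<delta> < \<bar>X m w\<bar>} \<union> ({w\<in>space M. \<delta> < \<bar>X' m w\<bar>} \<union> {w\<in>space M. K < \<bar>T m w\<bar>}))"
      proof (rule finite_measure_mono)
        show "{w\<in>space M. \<epsilon> < \<bar>Z m w - 0\<bar>} \<subseteq>
          {w\<in>space M. \<delta> < \<bar>X m w\<bar>} \<union> ({w\<in>space M. \<delta> < \<bar>X' m w\<bar>} \<union> {w\<in>space M. K < \<bar>T m w\<bar>})"
          using \<delta>(2)[of _ m] by (fastforce simp: not_le[symmetric])
      qed measurable
      also have "\<dots> \<le> \<P>(w in M. \<delta> < \<bar>X m w\<bar>) +
          prob ({w\<in>space M. \<delta> < \<bar>X' m w\<bar>} \<union> {w\<in>space M. K < \<bar>T m w\<bar>})"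
        by (rule measure_Un_le) measurable
      also have "prob ({w\<in>space M. \<delta> < \<bar>X' m w\<bar>} \<union> {w\<in>space M. K < \<bar>T m w\<bar>}) \<le>
          \<P>(w in M. \<delta> < \<bar>X' m w\<bar>) + \<P>(w in M. K < \<bar>T m w\<bar>)"
        by (rule measure_Un_le) measurable
      finally show ?case using elim K[of m] by linarith
    qed
  qed (use measure_nonneg in \<open>auto intro!: always_eventually elim: less_le_trans\<close>)
qed

lemma bounded_in_prob_const: "bounded_in_prob M (\<lambda>m w. c)"
  unfolding bounded_in_prob_def by (auto intro!: exI[of _ "\<bar>c\<bar>"])

lemma tendsto_in_prob_add_0:
  assumes [measurable]: "\<And>m. X m \<in> borel_measurable M" "\<And>m. X' m \<in> borel_measurable M"
    and "tendsto_in_prob M X 0" "tendsto_in_prob M X' 0"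
  shows "tendsto_in_prob M (\<lambda>m w. X m w + X' m w) 0"
proof (rule tendsto_in_prob_bound[where T = "\<lambda>_ _. 0", OF _ assms(1,2) _ assms(3,4)])
  fix \<epsilon> K :: real assume "\<epsilon> > 0"
  then show "\<exists>\<delta>>0. \<forall>m. \<forall>w\<in>space M. \<bar>X m w\<bar> \<le> \<delta> \<longrightarrow> \<bar>X' m w\<bar> \<le> \<delta> \<longrightarrow>
      \<bar>0 :: real\<bar> \<le> K \<longrightarrow> \<bar>X m w + X' m w\<bar> \<le> \<epsilon>"
    by (intro exI[of _ "\<epsilon> / 2"]) auto
qed (auto simp: bounded_in_prob_const)

lemma tendsto_in_prob_mult_bounded_0:
  assumes [measurable]: "\<And>m. X m \<in> borel_measurable M" "\<And>m. T m \<in> borel_measurable M"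
    and "tendsto_in_prob M X 0" "bounded_in_prob M T"
  shows "tendsto_in_prob M (\<lambda>m w. X m w * T m w) 0"
proof (rule tendsto_in_prob_bound[where T = T, OF _ assms(1,1) _ assms(3,3,4)])
  fix \<epsilon> K :: real assume *: "\<epsilon> > 0" "K > 0"
  show "\<exists>\<delta>>0. \<forall>m. \<forall>w\<in>space M. \<bar>X m w\<bar> \<le> \<delta> \<longrightarrow> \<bar>X m w\<bar> \<le> \<delta> \<longrightarrow>
      \<bar>T m w\<bar> \<le> K \<longrightarrow> \<bar>X m w * T m w\<bar> \<le> \<epsilon>"
  proof (intro exI[of _ "\<epsilon> / K"] conjI allI ballI impI)
    fix m w assume "\<bar>X m w\<bar> \<le> \<epsilon> / K" "\<bar>T m w\<bar> \<le> K"
    then have "\<bar>X m w\<bar> * \<bar>T m w\<bar> \<le> \<epsilon> / K * K" using * by (intro mult_mono) auto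
    then show "\<bar>X m w * T m w\<bar> \<le> \<epsilon>" using * by (simp add: abs_mult)
  qed (use * in auto)
qed auto

lemma tendsto_in_prob_mult_0:
  assumes [measurable]: "\<And>m. X m \<in> borel_measurable M" "\<And>m. X' m \<in> borel_measurable M"
    and "tendsto_in_prob M X 0" "tendsto_in_prob M X' 0"
  shows "tendsto_in_prob M (\<lambda>m w. X m w * X' m w) 0"
proof (rule tendsto_in_prob_bound[where T = "\<lambda>_ _. 0", OF _ assms(1,2) _ assms(3,4)])
  fix \<epsilon> K :: real assume *: "\<epsilon> > 0"
  show "\<exists>\<delta>>0. \<forall>m. \<forall>w\<in>space M. \<bar>X m w\<bar> \<le> \<delta> \<longrightarrow> \<bar>X' m w\<bar> \<le> \<delta> \<longrightarrow>
      \<bar>0 :: real\<bar> \<le> K \<longrightarrow> \<bar>X m w * X' m w\<bar> \<le> \<epsilon>"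
  \<comment> \<open>One factor is bounded by \<epsilon>, the other by 1.\<close>
  proof (intro exI[of _ "min \<epsilon> 1"] conjI allI ballI impI)
    fix m w assume "\<bar>X m w\<bar> \<le> min \<epsilon> 1" "\<bar>X' m w\<bar> \<le> min \<epsilon> 1"
    then have "\<bar>X m w\<bar> * \<bar>X' m w\<bar> \<le> \<epsilon> * 1" using * by (intro mult_mono) auto
    then show "\<bar>X m w * X' m w\<bar> \<le> \<epsilon>" by (simp add: abs_mult)
  qed (use * in auto)
qed (auto simp: bounded_in_prob_const)

text \<open>The hypothesis on \<open>Z\<close> leaves the junk values of a division by zero unconstrained.\<close>

lemma tendsto_in_prob_quotient_0:
  assumes [measurable]: "\<And>m. Z m \<in> borel_measurable M" "\<And>m. B m \<in> borel_measurable M"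
      "\<And>m. T m \<in> borel_measurable M"
    and B: "tendsto_in_prob M B b" "b \<noteq> 0" and T: "bounded_in_prob M T"
    and Z: "\<And>m w. w \<in> space M \<Longrightarrow> B m w \<noteq> 0 \<Longrightarrow> Z m w = T m w / B m w"
  shows "tendsto_in_prob M (\<lambda>m w. Z m w - T m w / b) 0"
proof (rule tendsto_in_prob_bound[where T = T and X = "\<lambda>m w. B m w - b" and X' = "\<lambda>m w. B m w - b"])
  fix \<epsilon> K :: real assume *: "\<epsilon> > 0" "K > 0"
  \<comment> \<open>The first term keeps \<open>B m w\<close> at distance at least
    \<open>\<bar>b\<bar> / 2\<close> from 0. The second makes the error bound
    \<open>K * \<delta> / (b\<^sup>2 / 2)\<close> equal to \<epsilon>.\<close>
  let ?\<delta> = "min (\<bar>b\<bar> / 2) (\<epsilon> * b\<^sup>2 / (2 * K))"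
  show "\<exists>\<delta>>0. \<forall>m. \<forall>w\<in>space M. \<bar>B m w - b\<bar> \<le> \<delta> \<longrightarrow> \<bar>B m w - b\<bar> \<le> \<delta> \<longrightarrow>
      \<bar>T m w\<bar> \<le> K \<longrightarrow> \<bar>Z m w - T m w / b\<bar> \<le> \<epsilon>"
  proof (intro exI[of _ ?\<delta>] conjI allI ballI impI)
    show "?\<delta> > 0" using * B(2) by auto
    fix m w assume w: "w \<in> space M" and a: "\<bar>B m w - b\<bar> \<le> ?\<delta>" "\<bar>T m w\<bar> \<le> K"
    have B2: "\<bar>B m w\<bar> \<ge> \<bar>b\<bar> / 2" using a(1) by linarith
    then have nz: "B m w \<noteq> 0" using B(2) by auto
    have "\<bar>Z m w - T m w / b\<bar> = \<bar>T m w\<bar> * \<bar>B m w - b\<bar> / (\<bar>B m w\<bar> * \<bar>b\<bar>)"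
    proof -
      have "Z m w - T m w / b = T m w * (b - B m w) / (B m w * b)"
        unfolding Z[OF w nz] using nz B(2) by (simp add: field_simps)
      then show ?thesis by (simp add: abs_mult abs_minus_commute)
    qed
    also have "\<dots> \<le> K * (\<epsilon> * b\<^sup>2 / (2 * K)) / (\<bar>b\<bar> / 2 * \<bar>b\<bar>)"
      using a B2 B(2) * by (intro frac_le mult_mono) (auto simp: zero_less_mult_iff)
    also have "\<dots> = \<epsilon>" using * B(2) by (simp add: power2_eq_square)
    finally show "\<bar>Z m w - T m w / b\<bar> \<le> \<epsilon>" .
  qed
qed (use B T in \<open>auto simp: tendsto_in_prob_diff_0\<close>)

subsection \<open>Slutsky's theorem\<close>

lemma cmod_iexp_diff_le: "cmod (iexp x - iexp y) \<le> \<bar>x - y\<bar>"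
proof -
  have "iexp x - iexp y = iexp y * (iexp (x - y) - 1)"
    by (simp add: algebra_simps exp_add[symmetric])
  then have "cmod (iexp x - iexp y) = cmod (iexp (x - y) - 1)"
    by (simp add: norm_mult)
  also have "\<dots> \<le> \<bar>x - y\<bar>" using iexp_approx1[of "x - y" 0] by simp
  finally show ?thesis .
qed

text \<open>The two characteristic functions at \<open>t\<close> differ by at most
  \<open>\<bar>t\<bar> * \<epsilon>\<close> from the event where \<open>Z\<close> and
  \<open>S\<close> are close, by the Lipschitz bound for \<open>iexp\<close>, plus twice the
  probability of its complement. Levy's continuity theorem turns this back into weak
  convergence.\<close>

theorem slutsky:
  assumes [measurable]: "\<And>m. S m \<in> borel_measurable M" "\<And>m. Z m \<in> borel_measurable M"
    and \<mu>: "real_distribution \<mu>"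
    and S: "weak_conv_m (\<lambda>m. distr M borel (S m)) \<mu>"
    and diff: "tendsto_in_prob M (\<lambda>m w. Z m w - S m w) 0"
  shows "weak_conv_m (\<lambda>m. distr M borel (Z m)) \<mu>"
proof (rule levy_continuity[OF _ \<mu>])
  fix t :: real
  let ?c = "\<lambda>V m. char (distr M borel (V m)) t"
  have c: "?c V m = (CLINT w|M. iexp (t * V m w))"
    if [measurable]: "V m \<in> borel_measurable M" for V :: "nat \<Rightarrow> 'a \<Rightarrow> real" and m
    unfolding char_def by (rule integral_distr) measurable
  have bound: "cmod (?c Z m - ?c S m) \<le> \<bar>t\<bar> * \<epsilon> + 2 * \<P>(w in M. \<epsilon> < \<bar>Z m w - S m w\<bar>)"
    if \<epsilon>: "\<epsilon> > 0" for m \<epsilon>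
  proof -
    have "?c Z m - ?c S m = (CLINT w|M. iexp (t * Z m w) - iexp (t * S m w))"
      unfolding c[of S, OF assms(1)] c[of Z, OF assms(2)]
      by (rule Bochner_Integration.integral_diff[symmetric]; rule integrable_iexp; simp)
    also have "cmod \<dots> \<le> (\<integral>w. \<bar>t\<bar> * \<epsilon> + 2 * indicator {w\<in>space M. \<epsilon> < \<bar>Z m w - S m w\<bar>} w \<partial>M)"
    proof (rule order_trans[OF integral_norm_bound integral_mono])
      fix w assume w: "w \<in> space M"
      show "cmod (iexp (t * Z m w) - iexp (t * S m w)) \<le>
          \<bar>t\<bar> * \<epsilon> + 2 * indicator {w\<in>space M. \<epsilon> < \<bar>Z m w - S m w\<bar>} w"
      proof (cases "\<epsilon> < \<bar>Z m w - S m w\<bar>")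
        case True
        have "cmod (iexp (t * Z m w) - iexp (t * S m w)) \<le> 1 + 1"
          by (rule order_trans[OF norm_triangle_ineq4]) simp
        also have "\<dots> \<le> \<bar>t\<bar> * \<epsilon> + 2" using \<epsilon> by simp
        finally show ?thesis using True w by simp
      next
        case False
        have "cmod (iexp (t * Z m w) - iexp (t * S m w)) \<le> \<bar>t * Z m w - t * S m w\<bar>"
          by (rule cmod_iexp_diff_le)
        also have "\<dots> = \<bar>t\<bar> * \<bar>Z m w - S m w\<bar>" by (simp add: abs_mult[symmetric] algebra_simps)
        also have "\<dots> \<le> \<bar>t\<bar> * \<epsilon>" using False by (intro mult_left_mono) auto
        finally show ?thesis using False by simp
      qed
    qed (auto intro!: Bochner_Integration.integrable_diff integrable_iexp integrable_real_indicator
        Bochner_Integration.integrable_add integrable_norm simp: less_top[symmetric])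
    also have "\<dots> = \<bar>t\<bar> * \<epsilon> + 2 * \<P>(w in M. \<epsilon> < \<bar>Z m w - S m w\<bar>)"
      by (subst Bochner_Integration.integral_add) (auto simp: prob_space less_top[symmetric])
    finally show ?thesis .
  qed
  have "(\<lambda>m. ?c Z m - ?c S m) \<longlonglongrightarrow> 0"
    unfolding tendsto_iff dist_norm diff_zero
  proof (intro allI impI)
    fix e :: real assume e: "e > 0"
    \<comment> \<open>The added 1 covers \<open>t = 0\<close>. Half of \<open>e\<close> pays for the
      Lipschitz part, the other half for twice a probability below \<open>e / 4\<close>.\<close>
    define \<epsilon> where "\<epsilon> = e / (2 * (\<bar>t\<bar> + 1))"
    have \<epsilon>: "\<epsilon> > 0" using e by (simp add: \<epsilon>_def)
    have t\<epsilon>: "\<bar>t\<bar> * \<epsilon> < e / 2" using e by (simp add: \<epsilon>_def field_simps)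
    have "(\<lambda>m. \<P>(w in M. \<epsilon> < \<bar>Z m w - S m w\<bar>)) \<longlonglongrightarrow> 0"
      using diff \<epsilon> by (simp add: tendsto_in_prob_def)
    from order_tendstoD(2)[OF this, of "e / 4"] e
    have "\<forall>\<^sub>F m in sequentially. \<P>(w in M. \<epsilon> < \<bar>Z m w - S m w\<bar>) < e / 4" by simp
    then show "\<forall>\<^sub>F m in sequentially. cmod (?c Z m - ?c S m) < e"
    proof eventually_elim
      case (elim m)
      with bound[OF \<epsilon>, of m] t\<epsilon> show ?case by linarith
    qed
  qed
  moreover have "?c S \<longlonglongrightarrow> char \<mu> t"
    by (rule levy_continuity1[OF _ \<mu> S]) auto
  ultimately show "?c Z \<longlonglongrightarrow> char \<mu> t"
    by (blast intro: Lim_transform)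
qed auto

end

subsection \<open>Samples of independent identically distributed variables\<close>

text \<open>The sample of size \<open>m\<close> consists of the first \<open>m\<close> terms of one
  infinite sequence, so \<open>m\<close> stands for n + N. Statistics are sums of functions of a
  single record, whose moments are computed under \<open>Q\<close>.\<close>

locale iid_sample = prob_space M for M :: "'a measure" +
  fixes N Q :: "'b measure" and D :: "nat \<Rightarrow> 'a \<Rightarrow> 'b"
  assumes D_indep: "indep_vars (\<lambda>_. N) D UNIV"
    and D_distr: "distr M N (D i) = Q"
begin

lemma D_measurable [measurable]: "D i \<in> M \<rightarrow>\<^sub>M N"
  using D_indep by (auto simp: indep_vars_def)

lemma sets_Q [measurable_cong]: "sets Q = sets N"
  using D_distr[of 0] by (metis sets_distr)

lemma prob_space_Q: "prob_space Q"
  using prob_space_distr[OF D_measurable] D_distr by metis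

lemma integral_sample: "g \<in> borel_measurable N \<Longrightarrow> expectation (\<lambda>w. g (D i w)) = (\<integral>z. g z \<partial>Q)"
  for g :: "'b \<Rightarrow> real"
  unfolding D_distr[of i, symmetric] by (simp add: integral_distr)

lemma integrable_sample:
  "g \<in> borel_measurable N \<Longrightarrow> integrable M (\<lambda>w. g (D i w)) \<longleftrightarrow> integrable Q g"
  for g :: "'b \<Rightarrow> real"
  unfolding D_distr[of i, symmetric] by (simp add: integrable_distr_eq)

lemma AE_sample:
  assumes "Measurable.pred N P" "AE z in Q. P z" shows "AE w in M. P (D i w)"
  using assms unfolding D_distr[of i, symmetric] by (simp add: AE_distr_iff pred_def)

definition scaled_sum :: "('b \<Rightarrow> real) \<Rightarrow> nat \<Rightarrow> 'a \<Rightarrow> real" where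
  "scaled_sum g m w = (\<Sum>i<m. g (D i w)) / sqrt m"

lemma scaled_sum_measurable [measurable]:
  assumes [measurable]: "g \<in> borel_measurable N"
  shows "scaled_sum g m \<in> borel_measurable M"
  unfolding scaled_sum_def by measurable

lemma indep_vars_sample:
  "g \<in> borel_measurable N \<Longrightarrow> indep_vars (\<lambda>_. borel) (\<lambda>i w. g (D i w)) UNIV"
  by (rule indep_vars_compose2[OF D_indep])

context
  fixes g :: "'b \<Rightarrow> real"
  assumes g_meas [measurable]: "g \<in> borel_measurable N"
    and g_sq: "integrable Q (\<lambda>z. (g z)\<^sup>2)"
    and g_mean: "(\<integral>z. g z \<partial>Q) = 0"
begin

text \<open>The off-diagonal terms of the expanded square vanish by independence and
  centring.\<close>

lemma second_moment_sum:
  "integrable M (\<lambda>w. (\<Sum>i<m. g (D i w))\<^sup>2)"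
  "expectation (\<lambda>w. (\<Sum>i<m. g (D i w))\<^sup>2) = m * (\<integral>z. (g z)\<^sup>2 \<partial>Q)"
proof -
  have sq: "integrable M (\<lambda>w. (g (D i w))\<^sup>2)" for i
    using g_sq integrable_sample[of "\<lambda>z. (g z)\<^sup>2" i] by simp
  have int: "integrable M (\<lambda>w. g (D i w))" for i
    by (rule square_integrable_imp_integrable[OF _ sq]) simp
  \<comment> \<open>Pairwise independence comes from the independence of one variable from a sum of
    others, the sum having the single index \<open>j\<close>.\<close>
  have ind: "indep_var borel (\<lambda>w. g (D i w)) borel (\<lambda>w. g (D j w))" if "i \<noteq> j" for i j
    using indep_vars_sum[of "{j}" i "\<lambda>i w. g (D i w)"] that
      indep_vars_subset[OF indep_vars_sample[OF g_meas], of "{i, j}"] by simp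
  have prod_int: "integrable M (\<lambda>w. g (D i w) * g (D j w))" for i j
    using indep_var_integrable[OF ind int int, of i j] sq[of i]
    by (cases "i = j") (auto simp: power2_eq_square)
  have prod: "expectation (\<lambda>w. g (D i w) * g (D j w)) = (if j = i then \<integral>z. (g z)\<^sup>2 \<partial>Q else 0)" for i j
    using indep_var_lebesgue_integral[OF ind int int, of i j] integral_sample[of "\<lambda>z. (g z)\<^sup>2" i]
    by (auto simp: power2_eq_square integral_sample g_mean)
  have eq: "(\<Sum>i<m. g (D i w))\<^sup>2 = (\<Sum>i<m. \<Sum>j<m. g (D i w) * g (D j w))" for w
    by (simp add: power2_eq_square sum_product)
  show "integrable M (\<lambda>w. (\<Sum>i<m. g (D i w))\<^sup>2)"
    unfolding eq by (auto intro!: prod_int)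
  show "expectation (\<lambda>w. (\<Sum>i<m. g (D i w))\<^sup>2) = m * (\<integral>z. (g z)\<^sup>2 \<partial>Q)"
    unfolding eq by (simp add: integral_sum prod_int prod)
qed

lemma bounded_in_prob_scaled_sum: "bounded_in_prob M (scaled_sum g)"
  unfolding bounded_in_prob_def
proof (intro allI impI)
  fix \<eta> :: real assume \<eta>: "\<eta> > 0"
  define v where "v = (\<integral>z. (g z)\<^sup>2 \<partial>Q)"
  have v: "v \<ge> 0" by (simp add: v_def)
  \<comment> \<open>Chebyshev's bound becomes \<open>v / K\<^sup>2 = \<eta> * v / (v + 1)\<close>,
    which is at most \<eta>. The added 1 keeps \<open>K\<close> positive when
    \<open>v = 0\<close>.\<close>
  define K where "K = sqrt ((v + 1) / \<eta>)"
  have K: "K > 0" "K\<^sup>2 = (v + 1) / \<eta>" using v \<eta> by (auto simp: K_def)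
  have sq: "(scaled_sum g m w)\<^sup>2 = (\<Sum>i<m. g (D i w))\<^sup>2 / m" for m w
    by (simp add: scaled_sum_def power_divide)
  have "\<P>(w in M. K < \<bar>scaled_sum g m w\<bar>) \<le> \<eta>" for m
  proof -
    have "\<P>(w in M. K < \<bar>scaled_sum g m w\<bar>) \<le> \<P>(w in M. K\<^sup>2 \<le> (scaled_sum g m w)\<^sup>2)"
      using K(1) by (intro finite_measure_mono) (auto simp: abs_le_square_iff[symmetric])
    also have "\<dots> \<le> expectation (\<lambda>w. (scaled_sum g m w)\<^sup>2) / K\<^sup>2"
      using K(1) second_moment_sum(1)
      by (intro integral_Markov_inequality_measure[where A = "{}"]) (auto simp: sq)
    \<comment> \<open>Equality holds for \<open>m > 0\<close>; for \<open>m = 0\<close> the scaled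
      sum is 0 by the convention for division, so only an inequality holds throughout.\<close>
    also have "expectation (\<lambda>w. (scaled_sum g m w)\<^sup>2) \<le> v"
      using v by (simp add: sq second_moment_sum(2) v_def)
    also have "v / K\<^sup>2 \<le> \<eta>" using K v \<eta> by (simp add: field_simps)
    finally show ?thesis by (simp add: divide_right_mono)
  qed
  then show "\<exists>K. \<forall>m. \<P>(w in M. K < \<bar>scaled_sum g m w\<bar>) \<le> \<eta>" by blast
qed

end

text \<open>The centred sample mean is the scaled sum, which is bounded in probability, times the
  null sequence \<open>1 / sqrt m\<close>.\<close>

lemma weak_law:
  assumes [measurable]: "g \<in> borel_measurable N" and sq: "integrable Q (\<lambda>z. (g z)\<^sup>2)"
  shows "tendsto_in_prob M (\<lambda>m w. (\<Sum>i<m. g (D i w)) / m) (\<integral>z. g z \<partial>Q)"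
proof -
  interpret Q: prob_space Q by (rule prob_space_Q)
  define e where "e = (\<integral>z. g z \<partial>Q)"
  have int: "integrable Q g" by (rule Q.square_integrable_imp_integrable[OF _ sq]) simp
  have e_sq: "integrable Q (\<lambda>z. (g z - e)\<^sup>2)"
    using sq int by (simp add: power2_diff)
  have mean: "(\<integral>z. g z - e \<partial>Q) = 0"
    using int by (simp add: e_def Q.prob_space)
  have null: "(\<lambda>m. 1 / sqrt (real m)) \<longlonglongrightarrow> 0"
    by real_asymp
  have "tendsto_in_prob M (\<lambda>m w. 1 / sqrt m) 0"
    unfolding tendsto_in_prob_def
  proof (intro allI impI)
    fix \<epsilon> :: real assume "\<epsilon> > 0"
    then have "\<forall>\<^sub>F m in sequentially. 1 / sqrt (real m) < \<epsilon>"
      using order_tendstoD(2)[OF null] by blast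
    then have "\<forall>\<^sub>F m in sequentially. \<P>(w in M. \<epsilon> < \<bar>1 / sqrt (real m) - 0\<bar>) = 0"
      by eventually_elim auto
    then show "(\<lambda>m. \<P>(w in M. \<epsilon> < \<bar>1 / sqrt (real m) - 0\<bar>)) \<longlonglongrightarrow> 0"
      by (rule tendsto_eventually)
  qed
  then have "tendsto_in_prob M (\<lambda>m w. 1 / sqrt m * scaled_sum (\<lambda>z. g z - e) m w) 0"
    by (intro tendsto_in_prob_mult_bounded_0 bounded_in_prob_scaled_sum e_sq mean) auto
  \<comment> \<open>At \<open>m = 0\<close> the left side is 0 and the right side
    \<open>- e\<close>, so the two sequences are identified only eventually.\<close>
  moreover have "1 / sqrt m * scaled_sum (\<lambda>z. g z - e) m w = (\<Sum>i<m. g (D i w)) / m - e" if "m > 0" for m w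
    using that by (simp add: scaled_sum_def sum_subtractf field_simps)
  then have "\<forall>\<^sub>F m in sequentially. \<P>(w in M. \<epsilon> < \<bar>1 / sqrt m * scaled_sum (\<lambda>z. g z - e) m w - 0\<bar>) =
      \<P>(w in M. \<epsilon> < \<bar>(\<Sum>i<m. g (D i w)) / m - e - 0\<bar>)" for \<epsilon>
    by (intro eventually_mono[OF eventually_gt_at_top[of 0]]) presburger
  ultimately have "tendsto_in_prob M (\<lambda>m w. (\<Sum>i<m. g (D i w)) / m - e) 0"
    unfolding tendsto_in_prob_def by (blast intro: Lim_transform_eventually)
  then show ?thesis by (simp add: tendsto_in_prob_diff_0 e_def)
qed

text \<open>Where the denominator does not vanish, the scaled error of the ratio is exactly the scaled sum
  of \<open>u - \<theta> v\<close> divided by the sample mean of \<open>v\<close>.\<close>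

lemma ratio_linearization:
  assumes [measurable]: "u \<in> borel_measurable N" "v \<in> borel_measurable N"
    and u: "integrable Q (\<lambda>z. (u z)\<^sup>2)" and v: "integrable Q (\<lambda>z. (v z)\<^sup>2)"
    and b: "(\<integral>z. v z \<partial>Q) \<noteq> 0"
  defines "\<theta> \<equiv> (\<integral>z. u z \<partial>Q) / (\<integral>z. v z \<partial>Q)"
  shows "tendsto_in_prob M (\<lambda>m w. sqrt m * ((\<Sum>i<m. u (D i w)) / (\<Sum>i<m. v (D i w)) - \<theta>)
    - scaled_sum (\<lambda>z. (u z - \<theta> * v z) / (\<integral>z. v z \<partial>Q)) m w) 0"
    and "integrable Q (\<lambda>z. ((u z - \<theta> * v z) / (\<integral>z. v z \<partial>Q))\<^sup>2)"
    and "(\<integral>z. (u z - \<theta> * v z) / (\<integral>z. v z \<partial>Q) \<partial>Q) = 0"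
proof -
  interpret Q: prob_space Q by (rule prob_space_Q)
  let ?b = "\<integral>z. v z \<partial>Q"
  have int: "integrable Q u" "integrable Q v"
    by (rule Q.square_integrable_imp_integrable[OF _ u] Q.square_integrable_imp_integrable[OF _ v]; simp)+
  have "integrable Q (\<lambda>z. u z * v z)"
    by (rule integrable_mult_square_integrable[OF _ _ u v]) simp_all
  moreover have "(u z - \<theta> * v z)\<^sup>2 = (u z)\<^sup>2 + \<theta>\<^sup>2 * (v z)\<^sup>2 - 2 * \<theta> * (u z * v z)" for z
    by (simp add: power2_eq_square algebra_simps)
  ultimately have sq: "integrable Q (\<lambda>z. (u z - \<theta> * v z)\<^sup>2)"
    using u v by simp
  then show "integrable Q (\<lambda>z. ((u z - \<theta> * v z) / ?b)\<^sup>2)"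
    by (simp add: power_divide)
  have mean: "(\<integral>z. u z - \<theta> * v z \<partial>Q) = 0"
    using int b by (simp add: \<theta>_def)
  then show "(\<integral>z. (u z - \<theta> * v z) / ?b \<partial>Q) = 0" by simp
  have "tendsto_in_prob M (\<lambda>m w. sqrt m * ((\<Sum>i<m. u (D i w)) / (\<Sum>i<m. v (D i w)) - \<theta>)
    - scaled_sum (\<lambda>z. u z - \<theta> * v z) m w / ?b) 0"
  proof (rule tendsto_in_prob_quotient_0[OF _ _ _ weak_law[OF _ v] b
        bounded_in_prob_scaled_sum[OF _ sq mean]])
    fix m :: nat and w assume nz: "(\<Sum>i<m. v (D i w)) / m \<noteq> 0"
    \<comment> \<open>Since a quotient by 0 is 0, \<open>nz\<close> excludes \<open>m = 0\<close> as
      well as a vanishing sum, so both side conditions of this identity are met.\<close>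
    have "s * (x / y - \<theta>) = (x - \<theta> * y) / s / (y / (s * s))" if "s \<noteq> 0" "y \<noteq> 0" for s x y :: real
      using that by (simp add: field_simps)
    from this[of "sqrt m" "\<Sum>i<m. v (D i w)"] nz
    show "sqrt m * ((\<Sum>i<m. u (D i w)) / (\<Sum>i<m. v (D i w)) - \<theta>) =
        scaled_sum (\<lambda>z. u z - \<theta> * v z) m w / ((\<Sum>i<m. v (D i w)) / m)"
      by (simp add: scaled_sum_def sum_subtractf sum_distrib_left)
  qed measurable
  then show "tendsto_in_prob M (\<lambda>m w. sqrt m * ((\<Sum>i<m. u (D i w)) / (\<Sum>i<m. v (D i w)) - \<theta>)
    - scaled_sum (\<lambda>z. (u z - \<theta> * v z) / ?b) m w) 0"
    by (simp add: scaled_sum_def sum_divide_distrib mult.commute)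
qed

end

section \<open>Central limit theorem, including zero variance\<close>

lemma real_distribution_normal_law: "v \<ge> 0 \<Longrightarrow> real_distribution (normal_law 0 v)"
  unfolding normal_law_def real_distribution_def real_distribution_axioms_def
  by (auto intro!: prob_space_return prob_space_normal_density)

text \<open>Transfers a standard normal limit to variance \<open>v\<close> by evaluating
  characteristic functions at \<open>sqrt v * t\<close>.\<close>

lemma normal_law_eq_distr:
  "v > 0 \<Longrightarrow> normal_law 0 v = distr std_normal_distribution borel (\<lambda>x. sqrt v * x)"
proof -
  assume v: "v > 0"
  interpret S: prob_space std_normal_distribution by (rule prob_space_normal_density) simp
  have "distributed std_normal_distribution lborel (\<lambda>x. x) std_normal_density"
    by (auto simp: distributed_def distr_id2)
  from S.normal_density_affine[OF this, of "sqrt v" 0] v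
  have "distributed std_normal_distribution lborel (\<lambda>x. sqrt v * x) (normal_density 0 (sqrt v))"
    by simp
  then have "distr std_normal_distribution lborel (\<lambda>x. sqrt v * x) = density lborel (\<lambda>x. ennreal (normal_density 0 (sqrt v) x))"
    by (simp add: distributed_def)
  moreover have "distr std_normal_distribution lborel (\<lambda>x. sqrt v * x) = distr std_normal_distribution borel (\<lambda>x. sqrt v * x)"
    by (rule distr_cong) auto
  ultimately show ?thesis using v by (simp add: normal_law_def)
qed

text \<open>For \<open>v = 0\<close> the function \<open>g\<close> vanishes almost surely, so every
  scaled sum has the point mass at 0 as its law. Otherwise the sums are standardized and scaled
  back. The degenerate case does occur: if Pr(R > \<alpha> | Y = 1) is 0 or 1, then
  \<open>\<phi>Y\<close> is 0 almost surely.\<close>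

lemma (in iid_sample) central_limit_scaled_sum:
  assumes [measurable]: "g \<in> borel_measurable N" and sq: "integrable Q (\<lambda>z. (g z)\<^sup>2)"
    and mean: "(\<integral>z. g z \<partial>Q) = 0" and v: "v = (\<integral>z. (g z)\<^sup>2 \<partial>Q)"
  shows "weak_conv_m (\<lambda>m. distr M borel (scaled_sum g m)) (normal_law 0 v)"
proof (cases "v = 0")
  case True
  have "AE z in Q. (g z)\<^sup>2 = 0"
    using integral_nonneg_eq_0_iff_AE[OF sq] True v by simp
  then have "AE w in M. g (D i w) = 0" for i
    by (intro AE_sample) auto
  then have "AE w in M. \<forall>i. g (D i w) = 0" by (simp add: AE_all_countable)
  then have "AE w in M. scaled_sum g m w = 0" for m
    by eventually_elim (simp add: scaled_sum_def)
  then have "distr M borel (scaled_sum g m) = distr M borel (\<lambda>_. 0)" for m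
    by (intro distr_cong_AE) auto
  then show ?thesis
    using True by (simp add: normal_law_def weak_conv_m_def weak_conv_def)
next
  case False
  have v_pos: "v > 0" using False v by (smt (verit) Bochner_Integration.integral_nonneg zero_le_power2)
  have weak: "weak_conv_m (\<lambda>m. distr M borel (\<lambda>w. (\<Sum>i<m. g (D i w)) / sqrt (m * (sqrt v)\<^sup>2)))
      std_normal_distribution"
  proof (rule central_limit_theorem_zero_mean[where \<mu> = "distr Q borel g"])
    show "distr M borel (\<lambda>w. g (D n w)) = distr Q borel g" for n
      unfolding D_distr[of n, symmetric] by (subst distr_distr) (auto simp: comp_def)
    show "integrable M (\<lambda>w. (g (D n w))\<^sup>2)" for n
      using integrable_sample[of "\<lambda>z. (g z)\<^sup>2" n] sq by simp
    show "variance (\<lambda>w. g (D n w)) = (sqrt v)\<^sup>2" for n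
      using integral_sample[of "\<lambda>z. (g z)\<^sup>2" n] v_pos by (simp add: integral_sample mean v)
  qed (use v_pos in \<open>auto simp: integral_sample mean intro: indep_vars_sample\<close>)
  have S: "scaled_sum g m = (\<lambda>w. sqrt v * ((\<Sum>i<m. g (D i w)) / sqrt (m * (sqrt v)\<^sup>2)))" for m
    using v_pos by (auto simp: scaled_sum_def real_sqrt_mult)
  have char_scale: "char (distr M' borel (\<lambda>x. c * h x)) t = char (distr M' borel h) (c * t)"
    if [measurable]: "h \<in> borel_measurable M'" for M' :: "'c measure" and h and c t :: real
    unfolding char_def by (simp add: integral_distr mult_ac)
  show ?thesis
  proof (rule levy_continuity)
    fix t
    have "(\<lambda>m. char (distr M borel (\<lambda>w. (\<Sum>i<m. g (D i w)) / sqrt (m * (sqrt v)\<^sup>2))) (sqrt v * t))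
        \<longlonglongrightarrow> char std_normal_distribution (sqrt v * t)"
      by (rule levy_continuity1[OF _ real_dist_normal_dist weak]) auto
    then show "(\<lambda>m. char (distr M borel (scaled_sum g m)) t) \<longlonglongrightarrow> char (normal_law 0 v) t"
      unfolding S normal_law_eq_distr[OF v_pos]
      by (subst char_scale, measurable, subst char_scale) (auto simp: distr_id2)
  qed (use v_pos in \<open>auto intro: real_distribution_normal_law\<close>)
qed

subsection \<open>Inverse probability weighting\<close>

text \<open>Conditioning on \<open>X\<close> replaces the joint indicator by its conditional
  expectation, which factors as \<open>p (X z)\<close> times that of the event on \<open>V\<close>.
  The weight cancels the first factor, and conditioning is then undone. The set \<open>B\<close>
  matches conditional independence, which is stated for events; it is used with \<open>UNIV\<close>
  for f(X) and with \<open>{1}\<close> for Y.\<close>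

lemma ipw_integral:
  fixes X :: "'a \<Rightarrow> 'b::topological_space" and U V :: "'a \<Rightarrow> real" and p h :: "'b \<Rightarrow> real"
  assumes Q: "prob_space Q"
    and [measurable]: "X \<in> borel_measurable Q" "U \<in> borel_measurable Q" "V \<in> borel_measurable Q"
      "p \<in> borel_measurable borel" "h \<in> borel_measurable borel" "B \<in> sets borel"
    and U: "AE z in Q. U z \<in> {0, 1}"
    and p: "AE z in Q. p (X z) = real_cond_exp Q (generated_by Q X) (\<lambda>z. of_bool (U z = 1)) z"
    and p_gt: "AE z in Q. \<epsilon> < p (X z)" "\<epsilon> > 0"
    and indep: "cond_indep_given Q U V X"
    and h: "integrable Q (\<lambda>z. h (X z))"
  shows "(\<integral>z. U z / p (X z) * (h (X z) * of_bool (V z \<in> B)) \<partial>Q) = (\<integral>z. h (X z) * of_bool (V z \<in> B) \<partial>Q)"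
proof -
  interpret Q: prob_space Q by fact
  let ?F = "generated_by Q X"
  have sub: "subalgebra Q ?F"
    unfolding generated_by_def subalgebra_def
    by (auto simp: sets_vimage_algebra2 intro: measurable_sets[OF assms(2)])
  interpret F: finite_measure_subalgebra Q ?F
    by unfold_locales (rule sub)
  have X_F: "X \<in> ?F \<rightarrow>\<^sub>M borel"
    unfolding generated_by_def by (rule measurable_vimage_algebra1) auto
  have F_meas: "(\<lambda>z. k (X z)) \<in> borel_measurable ?F" if "k \<in> borel_measurable borel" for k :: "'b \<Rightarrow> real"
    using measurable_compose[OF X_F that] .
  let ?V = "\<lambda>z. of_bool (V z \<in> B) :: real"
  let ?UV = "\<lambda>z. of_bool (U z \<in> {1} \<and> V z \<in> B) :: real"
  let ?E = "real_cond_exp Q ?F"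
  have [measurable]: "?V \<in> borel_measurable Q" "?UV \<in> borel_measurable Q"
    by (simp_all add: of_bool_def)
  \<comment> \<open>The lower bound on \<open>p\<close> makes \<open>h (X z) / \<epsilon>\<close> an
    integrable majorant.\<close>
  have int_UV: "integrable Q (\<lambda>z. h (X z) / p (X z) * ?UV z)"
  proof (rule Bochner_Integration.integrable_bound)
    show "integrable Q (\<lambda>z. h (X z) / \<epsilon>)" using h by simp
    show "AE z in Q. norm (h (X z) / p (X z) * ?UV z) \<le> norm (h (X z) / \<epsilon>)"
      using p_gt(1) by eventually_elim (use p_gt(2) in \<open>auto intro!: divide_left_mono\<close>)
  qed simp
  have int_V: "integrable Q (\<lambda>z. h (X z) * ?V z)"
    by (rule Bochner_Integration.integrable_bound[OF h]) auto
  have cond: "AE z in Q. ?E ?UV z = ?E (\<lambda>z. of_bool (U z \<in> {1})) z * ?E ?V z"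
    using indep[unfolded cond_indep_given_def, rule_format, of "{1}" B] by simp
  have "(\<integral>z. U z / p (X z) * (h (X z) * ?V z) \<partial>Q) = (\<integral>z. h (X z) / p (X z) * ?UV z \<partial>Q)"
  proof (rule integral_cong_AE)
    show "AE z in Q. U z / p (X z) * (h (X z) * ?V z) = h (X z) / p (X z) * ?UV z"
      using U by eventually_elim auto
  qed simp_all
  also have "\<dots> = (\<integral>z. h (X z) / p (X z) * ?E ?UV z \<partial>Q)"
    by (rule F.real_cond_exp_intg(2)[symmetric, OF int_UV F_meas]) simp_all
  also have "\<dots> = (\<integral>z. h (X z) * ?E ?V z \<partial>Q)"
  proof (rule integral_cong_AE)
    show "AE z in Q. h (X z) / p (X z) * ?E ?UV z = h (X z) * ?E ?V z"
      using p p_gt(1) cond by eventually_elim (use p_gt(2) in auto)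
  qed simp_all
  also have "\<dots> = (\<integral>z. h (X z) * ?V z \<partial>Q)"
    by (rule F.real_cond_exp_intg(2)[OF int_V F_meas]) simp_all
  finally show ?thesis .
qed

theorem corollary5p2p1:
  fixes M :: "'a measure"
    and Q :: "'d::finite full_data measure"
    and X :: "nat \<Rightarrow> 'a \<Rightarrow> real ^ 'd"
    and C Y :: "nat \<Rightarrow> 'a \<Rightarrow> real"
    and f \<pi> :: "real ^ 'd \<Rightarrow> real"
    and \<omega>_hat :: "nat \<Rightarrow> 'a \<Rightarrow> real"
    and r :: 'd
    and \<alpha> :: real
  defines "R \<equiv> \<lambda>z :: 'd full_data. cov_of z $ r"
  defines "\<phi>Y \<equiv> phi_TPR Q R \<alpha> (\<lambda>z. out_of z)"
    and "\<phi>f \<equiv> phi_TPR Q R \<alpha> (\<lambda>z. f (cov_of z))"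
    and "W \<equiv> \<lambda>z :: 'd full_data. obs_of z / \<pi> (cov_of z)"
    and "\<theta>0 \<equiv> \<P>(z in Q. R z > \<alpha> \<bar> out_of z = 1)"
    and "\<theta>_ipw \<equiv> \<lambda>m w.
           (\<Sum>i<m. C i w / \<pi> (X i w) * of_bool (X i w $ r > \<alpha>) * Y i w)
           / (\<Sum>i<m. C i w / \<pi> (X i w) * Y i w)"
    and "\<theta>f_ipw \<equiv> \<lambda>m w.
           (\<Sum>i<m. C i w / \<pi> (X i w) * of_bool (X i w $ r > \<alpha>) * f (X i w))
           / (\<Sum>i<m. C i w / \<pi> (X i w) * f (X i w))"
    and "\<theta>f \<equiv> \<lambda>m w.
           (\<Sum>i<m. of_bool (X i w $ r > \<alpha>) * f (X i w)) / (\<Sum>i<m. f (X i w))"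
  defines "\<theta>_hat \<equiv> \<lambda>m w. \<theta>_ipw m w + \<omega>_hat m w * (\<theta>f m w - \<theta>f_ipw m w)"
    and "\<sigma>2 \<equiv> prob_space.variance Q (\<lambda>z. W z * \<phi>Y z)
           - (covariance Q (\<lambda>z. W z * \<phi>Y z) (\<lambda>z. (1 - W z) * \<phi>f z))\<^sup>2
             / prob_space.variance Q (\<lambda>z. (1 - W z) * \<phi>f z)"
  assumes Q: "prob_space Q" "sets Q = sets full_data_algebra"
    and binary: "AE z in Q. obs_of z \<in> {0, 1} \<and> out_of z \<in> {0, 1}"
    and Y_prob: "0 < \<P>(z in Q. out_of z = 1)" "\<P>(z in Q. out_of z = 1) < 1"
    and \<pi>_meas: "\<pi> \<in> borel_measurable borel"
    and \<pi>: "AE z in Q. \<pi> (cov_of z) =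
          real_cond_exp Q (generated_by Q cov_of) (\<lambda>z. of_bool (obs_of z = 1)) z"
    and overlap: "\<exists>\<epsilon>>0. AE z in Q. \<epsilon> < \<pi> (cov_of z) \<and> \<pi> (cov_of z) < 1 - \<epsilon>"
    and ignorable: "cond_indep_given Q obs_of out_of cov_of"
    and f_meas: "f \<in> borel_measurable borel"
    and f_nonneg: "AE z in Q. f (cov_of z) \<ge> 0"
    and f_mean: "(\<integral>z. f (cov_of z) \<partial>Q) * (1 - (\<integral>z. f (cov_of z) \<partial>Q)) \<noteq> 0"
    and f_square: "integrable Q (\<lambda>z. (f (cov_of z))\<^sup>2)"
    and M: "prob_space M"
    and indep: "prob_space.indep_vars M (\<lambda>_. full_data_algebra)
          (\<lambda>i w. (X i w, C i w, Y i w)) UNIV"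
    and ident: "\<And>i. distr M full_data_algebra (\<lambda>w. (X i w, C i w, Y i w)) = Q"
    and var_pos: "prob_space.variance Q (\<lambda>z. (1 - W z) * \<phi>f z) > 0"
    and \<omega>_hat_meas: "\<And>m. \<omega>_hat m \<in> borel_measurable M"
    and \<omega>_hat_lim: "tendsto_in_prob M \<omega>_hat
          (covariance Q (\<lambda>z. W z * \<phi>Y z) (\<lambda>z. (W z - 1) * \<phi>f z)
           / prob_space.variance Q (\<lambda>z. (1 - W z) * \<phi>f z))"
  shows "weak_conv_m (\<lambda>m. distr M borel (\<lambda>w. sqrt (real m) * (\<theta>_hat m w - \<theta>0)))
           (normal_law 0 \<sigma>2)"
proof -
  let ?N = "full_data_algebra :: 'd full_data measure"
  interpret Q: prob_space Q by fact
  define D where "D i w = (X i w, C i w, Y i w)" for i w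
  interpret iid_sample M ?N Q D
    unfolding D_def[abs_def]
    by (rule iid_sample.intro[OF M iid_sample_axioms.intro[OF indep ident]])
  note [measurable] = \<pi>_meas f_meas
  define I where "I z = (of_bool (R z > \<alpha>) :: real)" for z
  have [measurable]: "(\<lambda>x :: real ^ 'd. x $ r) \<in> borel_measurable borel"
    by (intro borel_measurable_continuous_onI continuous_intros)
  have I_meas [measurable]: "I \<in> borel_measurable ?N"
    unfolding I_def R_def of_bool_def by measurable
  have W_meas [measurable]: "W \<in> borel_measurable ?N"
    unfolding W_def by measurable
  obtain \<epsilon> where \<epsilon>: "\<epsilon> > 0" and \<pi>_gt: "AE z in Q. \<epsilon> < \<pi> (cov_of z)"
    using overlap by (auto elim: eventually_mono)
  have C01: "AE z in Q. obs_of z \<in> {0, 1}" and Y01: "AE z in Q. out_of z \<in> {0, 1}"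
    using binary by auto

  \<comment> \<open>Unbiasedness of the weighted means\<close>
  define EY where "EY = (\<integral>z. out_of z \<partial>Q)"
  define Ef where "Ef = (\<integral>z. f (cov_of z) \<partial>Q)"

  \<comment> \<open>A binary outcome equals the indicator of the event that it is 1, the form in
    which \<open>ipw\<close> applies.\<close>
  have Y_ind: "(\<integral>z. k z * out_of z \<partial>Q) = (\<integral>z. k z * of_bool (out_of z \<in> {1}) \<partial>Q)"
    if [measurable]: "k \<in> borel_measurable ?N" for k :: "'d full_data \<Rightarrow> real"
  proof (rule integral_cong_AE)
    show "AE z in Q. k z * out_of z = k z * of_bool (out_of z \<in> {1})"
      using Y01 by eventually_elim auto
  qed (simp_all add: of_bool_def)
  have f_int: "integrable Q (\<lambda>z. f (cov_of z))"
    by (rule Q.square_integrable_imp_integrable[OF _ f_square]) simp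
  have If_sq: "integrable Q (\<lambda>z. (I z * f (cov_of z))\<^sup>2)"
    by (rule Bochner_Integration.integrable_bound[OF f_square]) (simp, simp add: I_def)
  have If_int: "integrable Q (\<lambda>z. I z * f (cov_of z))"
    by (rule Q.square_integrable_imp_integrable[OF _ If_sq]) simp
  have I_int: "integrable Q I"
    by (rule Q.integrable_const_bound[where B = 1]) (simp add: I_def, simp)

  have ipw: "(\<integral>z. W z * (h (cov_of z) * of_bool (out_of z \<in> B)) \<partial>Q) =
      (\<integral>z. h (cov_of z) * of_bool (out_of z \<in> B) \<partial>Q)"
    if "h \<in> borel_measurable borel" "B \<in> sets borel" "integrable Q (\<lambda>z. h (cov_of z))" for h B
    unfolding W_def
    by (rule ipw_integral[OF Q(1) _ _ _ \<pi>_meas that(1,2) C01 \<pi> \<pi>_gt \<epsilon> ignorable that(3)]) simp_all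
  have ipw1: "(\<integral>z. W z * h (cov_of z) \<partial>Q) = (\<integral>z. h (cov_of z) \<partial>Q)"
    if "h \<in> borel_measurable borel" "integrable Q (\<lambda>z. h (cov_of z))" for h
    using ipw[OF that(1) _ that(2), of UNIV] by simp
  have ipwY: "(\<integral>z. W z * (h (cov_of z) * out_of z) \<partial>Q) = (\<integral>z. h (cov_of z) * out_of z \<partial>Q)"
    if [measurable]: "h \<in> borel_measurable borel" and "integrable Q (\<lambda>z. h (cov_of z))" for h
    using ipw[OF that(1) _ that(2), of "{1}"] Y_ind[of "\<lambda>z. W z * h (cov_of z)"]
      Y_ind[of "\<lambda>z. h (cov_of z)"] by (simp add: mult.assoc)
  have [measurable]: "(\<lambda>x. of_bool (x $ r > \<alpha>) :: real) \<in> borel_measurable borel"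
    unfolding of_bool_def by measurable
  have I_eq: "I = (\<lambda>z. of_bool (cov_of z $ r > \<alpha>))" by (auto simp: I_def R_def)
  have E_WIY: "(\<integral>z. W z * (I z * out_of z) \<partial>Q) = (\<integral>z. I z * out_of z \<partial>Q)"
    using I_int unfolding I_eq by (intro ipwY) simp_all
  have E_WY: "(\<integral>z. W z * out_of z \<partial>Q) = EY"
    using ipwY[OF borel_measurable_const[of 1] Q.integrable_const] by (simp only: EY_def mult_1)
  have E_WIf: "(\<integral>z. W z * (I z * f (cov_of z)) \<partial>Q) = (\<integral>z. I z * f (cov_of z) \<partial>Q)"
    using If_int unfolding I_eq by (intro ipw1) simp_all
  have E_Wf: "(\<integral>z. W z * f (cov_of z) \<partial>Q) = Ef"
    unfolding Ef_def by (rule ipw1[OF f_meas f_int])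

  \<comment> \<open>Square integrability; the weight is bounded by 1/\<epsilon>\<close>
  have W_sq: "integrable Q (\<lambda>z. (W z * k z)\<^sup>2)"
    if [measurable]: "k \<in> borel_measurable ?N" and k: "integrable Q (\<lambda>z. (k z)\<^sup>2)" for k
  proof (rule Bochner_Integration.integrable_bound)
    show "integrable Q (\<lambda>z. (1 / \<epsilon>)\<^sup>2 * (k z)\<^sup>2)" using k by simp
    show "AE z in Q. norm ((W z * k z)\<^sup>2) \<le> norm ((1 / \<epsilon>)\<^sup>2 * (k z)\<^sup>2)"
      using \<pi>_gt C01
    proof eventually_elim
      case (elim z)
      then have "\<bar>W z\<bar> \<le> 1 / \<epsilon>" using \<epsilon> by (auto simp: W_def intro!: frac_le)
      then have "(W z)\<^sup>2 \<le> (1 / \<epsilon>)\<^sup>2" using power_mono[of "\<bar>W z\<bar>" "1 / \<epsilon>" 2] by simp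
      then show ?case by (simp add: power_mult_distrib mult_right_mono)
    qed
  qed simp
  have Y_sq: "integrable Q (\<lambda>z. (out_of z)\<^sup>2)" "integrable Q (\<lambda>z. (I z * out_of z)\<^sup>2)"
  proof -
    have "AE z in Q. norm ((out_of z)\<^sup>2) \<le> 1" "AE z in Q. norm ((I z * out_of z)\<^sup>2) \<le> 1"
      using Y01 by (auto elim!: eventually_mono simp: I_def)
    from this[THEN Q.integrable_const_bound]
    show "integrable Q (\<lambda>z. (out_of z)\<^sup>2)" "integrable Q (\<lambda>z. (I z * out_of z)\<^sup>2)"
      by simp_all
  qed

  \<comment> \<open>The true positive rate as a ratio of means\<close>
  have prob_Y: "\<P>(z in Q. P z \<and> out_of z = 1) = (\<integral>z. of_bool (P z) * out_of z \<partial>Q)"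
    if [measurable]: "Measurable.pred ?N P" for P
  proof -
    have "\<P>(z in Q. P z \<and> out_of z = 1) = (\<integral>z. indicator {z\<in>space Q. P z \<and> out_of z = 1} z \<partial>Q)"
      by simp
    also have "\<dots> = (\<integral>z. of_bool (P z) * of_bool (out_of z \<in> {1}) \<partial>Q)"
      by (rule Bochner_Integration.integral_cong) (auto simp: indicator_def)
    also have "\<dots> = (\<integral>z. of_bool (P z) * out_of z \<partial>Q)"
      by (rule Y_ind[symmetric]) (simp add: of_bool_def)
    finally show ?thesis .
  qed
  have [measurable]: "Measurable.pred ?N (\<lambda>z. R z > \<alpha>)" unfolding R_def by measurable
  have EY: "EY = \<P>(z in Q. out_of z = 1)"
    using prob_Y[of "\<lambda>_. True"] by (simp add: EY_def)
  have \<theta>0: "\<theta>0 = (\<integral>z. I z * out_of z \<partial>Q) / EY"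
    unfolding \<theta>0_def cond_prob_def EY using prob_Y[of "\<lambda>z. R z > \<alpha>"] by (simp add: I_def)
  have EY_nz: "EY \<noteq> 0" using EY Y_prob by simp
  have Ef_nz: "Ef \<noteq> 0" using f_mean by (auto simp: Ef_def)

  \<comment> \<open>The common limit of the weighted and unweighted surrogate ratios. It may differ
    from \<open>\<theta>0\<close>, but it cancels in their difference.\<close>
  define \<theta>f0 where "\<theta>f0 = (\<integral>z. I z * f (cov_of z) \<partial>Q) / Ef"
  have \<phi>Y_eq: "\<phi>Y z = (I z * out_of z - \<theta>0 * out_of z) / EY" for z
    unfolding \<phi>Y_def phi_TPR_def \<theta>0 EY_def I_def by (simp add: power2_eq_square diff_divide_distrib)
  have \<phi>f_eq: "\<phi>f z = (I z * f (cov_of z) - \<theta>f0 * f (cov_of z)) / Ef" for z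
    unfolding \<phi>f_def phi_TPR_def \<theta>f0_def Ef_def I_def by (simp add: power2_eq_square diff_divide_distrib)
  have [measurable]: "\<phi>Y \<in> borel_measurable ?N" "\<phi>f \<in> borel_measurable ?N"
    unfolding \<phi>Y_eq[abs_def] \<phi>f_eq[abs_def] by measurable

  have gY: "(\<lambda>z. (W z * (I z * out_of z) - \<theta>0 * (W z * out_of z)) / EY) = (\<lambda>z. W z * \<phi>Y z)"
    by (auto simp: \<phi>Y_eq algebra_simps)
  have gf_ipw: "(\<lambda>z. (W z * (I z * f (cov_of z)) - \<theta>f0 * (W z * f (cov_of z))) / Ef) = (\<lambda>z. W z * \<phi>f z)"
    by (auto simp: \<phi>f_eq algebra_simps)
  have gf: "(\<lambda>z. (I z * f (cov_of z) - \<theta>f0 * f (cov_of z)) / Ef) = \<phi>f"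
    by (auto simp: \<phi>f_eq)

  define eY where "eY m w = sqrt m * (\<theta>_ipw m w - \<theta>0) - scaled_sum (\<lambda>z. W z * \<phi>Y z) m w" for m w
  define ef_ipw where "ef_ipw m w = sqrt m * (\<theta>f_ipw m w - \<theta>f0) - scaled_sum (\<lambda>z. W z * \<phi>f z) m w" for m w
  define ef where "ef m w = sqrt m * (\<theta>f m w - \<theta>f0) - scaled_sum \<phi>f m w" for m w

  have \<theta>_ipw_eq: "\<theta>_ipw m w =
      (\<Sum>i<m. W (D i w) * (I (D i w) * out_of (D i w))) / (\<Sum>i<m. W (D i w) * out_of (D i w))" for m w
    by (simp add: \<theta>_ipw_def W_def I_def R_def D_def mult.assoc)
  have \<theta>f_ipw_eq: "\<theta>f_ipw m w =
      (\<Sum>i<m. W (D i w) * (I (D i w) * f (cov_of (D i w)))) / (\<Sum>i<m. W (D i w) * f (cov_of (D i w)))" for m w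
    by (simp add: \<theta>f_ipw_def W_def I_def R_def D_def mult.assoc)
  have \<theta>f_eq: "\<theta>f m w =
      (\<Sum>i<m. I (D i w) * f (cov_of (D i w))) / (\<Sum>i<m. f (cov_of (D i w)))" for m w
    by (simp add: \<theta>f_def I_def R_def D_def)
  have [measurable]: "\<theta>_ipw m \<in> borel_measurable M" "\<theta>f_ipw m \<in> borel_measurable M"
    "\<theta>f m \<in> borel_measurable M" for m
    unfolding \<theta>_ipw_eq[abs_def] \<theta>f_ipw_eq[abs_def] \<theta>f_eq[abs_def] by measurable
  have [measurable]: "eY m \<in> borel_measurable M" "ef_ipw m \<in> borel_measurable M"
    "ef m \<in> borel_measurable M" for m
    unfolding eY_def[abs_def] ef_ipw_def[abs_def] ef_def[abs_def] by measurable

  have lin_Y: "tendsto_in_prob M eY 0" "integrable Q (\<lambda>z. (W z * \<phi>Y z)\<^sup>2)" "(\<integral>z. W z * \<phi>Y z \<partial>Q) = 0"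
    using ratio_linearization[of "\<lambda>z. W z * (I z * out_of z)" "\<lambda>z. W z * out_of z"] EY_nz
    by (simp_all add: W_sq Y_sq E_WIY E_WY \<theta>0[symmetric] gY \<theta>_ipw_eq[symmetric] eY_def[abs_def] fun_cong[OF gY])
  have lin_f_ipw: "tendsto_in_prob M ef_ipw 0" "integrable Q (\<lambda>z. (W z * \<phi>f z)\<^sup>2)" "(\<integral>z. W z * \<phi>f z \<partial>Q) = 0"
    using ratio_linearization[of "\<lambda>z. W z * (I z * f (cov_of z))" "\<lambda>z. W z * f (cov_of z)"] Ef_nz
    by (simp_all add: W_sq f_square If_sq E_WIf E_Wf \<theta>f0_def[symmetric] gf_ipw \<theta>f_ipw_eq[symmetric] ef_ipw_def[abs_def] fun_cong[OF gf_ipw])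
  have lin_f: "tendsto_in_prob M ef 0" "integrable Q (\<lambda>z. (\<phi>f z)\<^sup>2)" "(\<integral>z. \<phi>f z \<partial>Q) = 0"
    using ratio_linearization[of "\<lambda>z. I z * f (cov_of z)" "\<lambda>z. f (cov_of z)"] Ef_nz
    by (simp_all add: f_square If_sq Ef_def[symmetric] \<theta>f0_def[symmetric] gf \<theta>f_eq[symmetric] ef_def[abs_def] fun_cong[OF gf])

  \<comment> \<open>The zero-mean correction term and the limiting variance\<close>
  \<comment> \<open>The influence function of \<open>\<theta>f - \<theta>f_ipw\<close>.\<close>
  define k where "k z = (1 - W z) * \<phi>f z" for z
  have [measurable]: "k \<in> borel_measurable ?N" unfolding k_def[abs_def] by measurable
  have k_alt: "k z = \<phi>f z - W z * \<phi>f z" for z by (simp add: k_def algebra_simps)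
  have Q_int: "integrable Q u" if "u \<in> borel_measurable ?N" "integrable Q (\<lambda>z. (u z)\<^sup>2)" for u :: "_ \<Rightarrow> real"
    by (rule Q.square_integrable_imp_integrable) (use that in simp_all)
  have k_sq: "integrable Q (\<lambda>z. (k z)\<^sup>2)"
    unfolding k_alt power2_diff
    using lin_f_ipw(2) lin_f(2) integrable_mult_square_integrable[of \<phi>f Q "\<lambda>z. W z * \<phi>f z"]
    by (simp add: mult.assoc)
  have k_mean: "(\<integral>z. k z \<partial>Q) = 0"
    unfolding k_alt using lin_f_ipw(2,3) lin_f(2,3) by (simp add: Q_int)

  define V c where "V = (\<integral>z. (k z)\<^sup>2 \<partial>Q)" and "c = (\<integral>z. W z * \<phi>Y z * k z \<partial>Q)"
  \<comment> \<open>The minimizer of \<open>2 * \<omega> * c + \<omega>\<^sup>2 * V\<close>, with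
    minimum \<open>- c\<^sup>2 / V\<close>. The minus sign arises because the assumed limit uses
    \<open>W - 1\<close> whereas \<open>k\<close> uses \<open>1 - W\<close>.\<close>
  define \<omega>0 where "\<omega>0 = - c / V"
  have V: "Q.variance (\<lambda>z. (1 - W z) * \<phi>f z) = V"
    using k_mean by (simp add: V_def k_def)
  have V_pos: "V > 0" using var_pos V by simp
  have c: "covariance Q (\<lambda>z. W z * \<phi>Y z) (\<lambda>z. (1 - W z) * \<phi>f z) = c"
    using k_mean lin_Y(3) by (simp add: covariance_def c_def k_def)
  have neg_k: "(W z - 1) * \<phi>f z = - k z" for z by (simp add: k_def algebra_simps)
  have c_neg: "covariance Q (\<lambda>z. W z * \<phi>Y z) (\<lambda>z. (W z - 1) * \<phi>f z) = - c"
    unfolding neg_k using k_mean lin_Y(3) by (simp add: covariance_def c_def)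
  have \<omega>_lim: "tendsto_in_prob M \<omega>_hat \<omega>0"
    using \<omega>_hat_lim unfolding c_neg V \<omega>0_def .

  define g where "g z = W z * \<phi>Y z + \<omega>0 * k z" for z
  have [measurable]: "g \<in> borel_measurable ?N" unfolding g_def[abs_def] by measurable
  have Yk_int: "integrable Q (\<lambda>z. W z * \<phi>Y z * k z)"
    by (rule integrable_mult_square_integrable) (use lin_Y(2) k_sq in simp_all)
  have g_sq_eq: "(g z)\<^sup>2 = (W z * \<phi>Y z)\<^sup>2 + (2 * \<omega>0 * (W z * \<phi>Y z * k z) + \<omega>0\<^sup>2 * (k z)\<^sup>2)" for z
    unfolding g_def by (simp add: power2_eq_square algebra_simps)
  have g_sq: "integrable Q (\<lambda>z. (g z)\<^sup>2)"
    unfolding g_sq_eq using lin_Y(2) k_sq Yk_int by simp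
  have g_mean: "(\<integral>z. g z \<partial>Q) = 0"
    unfolding g_def using lin_Y(2,3) k_sq k_mean by (simp add: Q_int)
  have "(\<integral>z. (g z)\<^sup>2 \<partial>Q) = (\<integral>z. (W z * \<phi>Y z)\<^sup>2 \<partial>Q) + (2 * \<omega>0 * c + \<omega>0\<^sup>2 * V)"
    unfolding g_sq_eq c_def V_def using lin_Y(2) k_sq Yk_int by simp
  also have "2 * \<omega>0 * c + \<omega>0\<^sup>2 * V = - (c\<^sup>2 / V)"
    using V_pos by (simp add: \<omega>0_def power2_eq_square field_simps)
  also have "(\<integral>z. (W z * \<phi>Y z)\<^sup>2 \<partial>Q) = Q.variance (\<lambda>z. W z * \<phi>Y z)"
    using lin_Y(3) by simp
  finally have \<sigma>2: "\<sigma>2 = (\<integral>z. (g z)\<^sup>2 \<partial>Q)"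
    unfolding \<sigma>2_def c V by simp

  \<comment> \<open>Replacement of the estimated coefficient and the normal limit\<close>
  have [measurable]: "\<omega>_hat m \<in> borel_measurable M" for m by (rule \<omega>_hat_meas)
  have scaled_k: "scaled_sum k m w = scaled_sum \<phi>f m w - scaled_sum (\<lambda>z. W z * \<phi>f z) m w" for m w
    by (simp add: scaled_sum_def k_alt sum_subtractf diff_divide_distrib)
  have scaled_g: "scaled_sum g m w = scaled_sum (\<lambda>z. W z * \<phi>Y z) m w + \<omega>0 * scaled_sum k m w" for m w
    by (simp add: scaled_sum_def g_def sum.distrib sum_distrib_left add_divide_distrib)
  \<comment> \<open>The remainder for the difference of the surrogate ratios. The subtraction is
    written as a product with a constant so that the rules for sums and products apply.\<close>
  define d where "d m w = ef m w + ef_ipw m w * - 1" for m w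
  have [measurable]: "d m \<in> borel_measurable M" for m unfolding d_def[abs_def] by measurable
  have d: "tendsto_in_prob M d 0"
    unfolding d_def[abs_def]
    by (intro tendsto_in_prob_add_0 tendsto_in_prob_mult_bounded_0 bounded_in_prob_const lin_f(1) lin_f_ipw(1)) simp_all
  have \<omega>: "tendsto_in_prob M (\<lambda>m w. \<omega>_hat m w - \<omega>0) 0"
    using \<omega>_lim by (simp add: tendsto_in_prob_diff_0)
  \<comment> \<open>The products are, in order: null times bounded, null times null, and null times
    constant.\<close>
  have "tendsto_in_prob M (\<lambda>m w. eY m w + ((\<omega>_hat m w - \<omega>0) * scaled_sum k m w +
      ((\<omega>_hat m w - \<omega>0) * d m w + d m w * \<omega>0))) 0"
    by (intro tendsto_in_prob_add_0 tendsto_in_prob_mult_bounded_0[OF _ _ \<omega>]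
        tendsto_in_prob_mult_bounded_0[OF _ _ d] tendsto_in_prob_mult_0[OF _ _ \<omega> d]
        bounded_in_prob_const bounded_in_prob_scaled_sum k_sq k_mean lin_Y(1)) simp_all
  \<comment> \<open>The scaled difference of the surrogate ratios is
    \<open>scaled_sum k m w + d m w\<close>; it is multiplied by \<open>\<omega>_hat m w\<close>,
    split as \<open>\<omega>0\<close> plus its error.\<close>
  moreover have "eY m w + ((\<omega>_hat m w - \<omega>0) * scaled_sum k m w +
      ((\<omega>_hat m w - \<omega>0) * d m w + d m w * \<omega>0)) = sqrt m * (\<theta>_hat m w - \<theta>0) - scaled_sum g m w" for m w
    unfolding \<theta>_hat_def eY_def d_def ef_def ef_ipw_def scaled_g scaled_k by (simp add: algebra_simps)
  ultimately have rem: "tendsto_in_prob M (\<lambda>m w. sqrt m * (\<theta>_hat m w - \<theta>0) - scaled_sum g m w) 0"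
    by simp
  have [measurable]: "\<theta>_hat m \<in> borel_measurable M" for m unfolding \<theta>_hat_def by measurable
  show ?thesis
  proof (rule slutsky[OF _ _ _ _ rem])
    show "weak_conv_m (\<lambda>m. distr M borel (scaled_sum g m)) (normal_law 0 \<sigma>2)"
      by (rule central_limit_scaled_sum[OF _ g_sq g_mean \<sigma>2]) simp
    \<comment> \<open>Nonnegativity of \<open>\<sigma>2\<close> comes from its form as the second
      moment of \<open>g\<close>.\<close>
    show "real_distribution (normal_law 0 \<sigma>2)"
      by (rule real_distribution_normal_law) (simp add: \<sigma>2)
  qed simp_all
qed

end
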